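(* Suppose the number of $n\ge1$ with $\Delta_{n-1}\Delta_n>0$ is finite and that both $\alpha_0'$ and $\beta_0'$ are real. Let $N$ be a natural number such that $\Delta_{n-1}\Delta_n<0$ and $\Delta_{n-1}'\Delta_n'<0$ for all $n>N$ (such an $N$ exists). If $$\Delta_N\Delta_N'(\alpha_0-\alpha_0')(\beta_0-\beta_0')<0,$$ then $$\lim_{n\to\infty}\left(\beta_n'+\frac{r_{n-2}}{r_{n-1}}\alpha_n'+\frac{r_{n-3}}{r_{n-1}}\right)=0.$$
   Context: For real $x$ let $[x]$ be the greatest integer $\le x$ and $\{x\}=x-[x]$. Let $\alpha_0,\beta_0$ be real algebraic irrational numbers with $0\le\alpha_0\le\beta_0$, $1\le\beta_0$, and assume $1,\alpha_0,\beta_0$ are linearly independent over $\mathbf{Q}$. The Jacobi-Perron algorithm (dimension 2) defines, for $n\ge1$, $\alpha_n=\{\beta_{n-1}\}/\{\alpha_{n-1}\}$ and $\beta_n=1/\{\alpha_{n-1}\}$ (all $\{\alpha_n\},\{\beta_n\}$ are nonzero). Put $a_n=[\alpha_n]$, $b_n=[\beta_n]$ for $n\ge0$. Define $(r_{-2},r_{-1},r_0)=(0,0,1)$, $(p_{-2},p_{-1},p_0)=(1,0,a_0)$, $(q_{-2},q_{-1},q_0)=(0,1,b_0)$, and for $n\ge1$: $r_n=r_{n-1}b_n+r_{n-2}a_n+r_{n-3}$, $p_n=p_{n-1}b_n+p_{n-2}a_n+p_{n-3}$, $q_n=q_{n-1}b_n+q_{n-2}a_n+q_{n-3}$. Set $\Delta_n=p_n-\alpha_0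 r_n$ and $\Delta_n'=q_n-\beta_0 r_n$ for $n\ge0$ (here the prime on $\Delta_n'$ does not denote conjugation). Let $\alpha_0'\ne\alpha_0$ and $\beta_0'\ne\beta_0$ be algebraic conjugates of $\alpha_0$ and $\beta_0$, respectively. The numbers $\alpha_n',\beta_n'$ $(n\ge1)$ are defined successively by $\alpha_{n-1}'=a_{n-1}+\dfrac{1}{\beta_n'}$ and $\beta_{n-1}'=b_{n-1}+\dfrac{\alpha_n'}{\beta_n'}$, i.e. $\beta_n'=1/(\alpha_{n-1}'-a_{n-1})$ and $\alpha_n'=(\beta_{n-1}'-b_{n-1})/(\alpha_{n-1}'-a_{n-1})$; it is assumed that these are defined for all $n$ (no denominator $\alpha_{n-1}'-a_{n-1}$ vanishes). *)

theory Defs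
  imports Complex_Main "HOL-Computational_Algebra.Polynomial"
begin

definition rat_lin_indep3 :: "real \<Rightarrow> real \<Rightarrow> real \<Rightarrow> bool" where
  "rat_lin_indep3 x y z \<longleftrightarrow>
     (\<forall>u v w :: rat. of_rat u * x + of_rat v * y + of_rat w * z = 0 \<longrightarrow> u = 0 \<and> v = 0 \<and> w = 0)"

text \<open>Roots of a common irreducible polynomial over the rationals, which up to a scalar is then
  the minimal polynomial of both.\<close>

definition algebraic_conjugates :: "'a::field_char_0 \<Rightarrow> 'a \<Rightarrow> bool" where
  "algebraic_conjugates x y \<longleftrightarrow>
     (\<exists>f :: rat poly. irreducible f \<and> poly (map_poly of_rat f) x = 0 \<and> poly (map_poly of_rat f) y = 0)"

fun jp :: "real \<Rightarrow> real \<Rightarrow> nat \<Rightarrow> real \<times> real" where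
  "jp \<alpha> \<beta> 0 = (\<alpha>, \<beta>)"
| "jp \<alpha> \<beta> (Suc n) =
     (let (x, y) = jp \<alpha> \<beta> n in (frac y / frac x, 1 / frac x))"

definition jp_a :: "real \<Rightarrow> real \<Rightarrow> nat \<Rightarrow> int" where
  "jp_a \<alpha> \<beta> n = \<lfloor>fst (jp \<alpha> \<beta> n)\<rfloor>"

definition jp_b :: "real \<Rightarrow> real \<Rightarrow> nat \<Rightarrow> int" where
  "jp_b \<alpha> \<beta> n = \<lfloor>snd (jp \<alpha> \<beta> n)\<rfloor>"

text \<open>The value at the natural number \<open>k\<close> is the term of index \<open>k - 2\<close> of the sequence;
  \<open>u\<close>, \<open>v\<close>, \<open>w\<close> are the terms of index \<open>-2\<close>, \<open>-1\<close>, \<open>0\<close>.\<close>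

fun jp_rec :: "int \<Rightarrow> int \<Rightarrow> int \<Rightarrow> (nat \<Rightarrow> int) \<Rightarrow> (nat \<Rightarrow> int) \<Rightarrow> nat \<Rightarrow> int" where
  "jp_rec u v w a b 0 = u"
| "jp_rec u v w a b (Suc 0) = v"
| "jp_rec u v w a b (Suc (Suc 0)) = w"
| "jp_rec u v w a b (Suc (Suc (Suc k))) =
     jp_rec u v w a b (Suc (Suc k)) * b (Suc k) + jp_rec u v w a b (Suc k) * a (Suc k)
       + jp_rec u v w a b k"

text \<open>The following three are indexed as in the usual notation, from \<open>-2\<close> on; their values at
  smaller indices are meaningless.\<close>

definition jp_r :: "real \<Rightarrow> real \<Rightarrow> int \<Rightarrow> int" where
  "jp_r \<alpha> \<beta> n = jp_rec 0 0 1 (jp_a \<alpha> \<beta>) (jp_b \<alpha> \<beta>) (nat (n + 2))"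

definition jp_p :: "real \<Rightarrow> real \<Rightarrow> int \<Rightarrow> int" where
  "jp_p \<alpha> \<beta> n = jp_rec 1 0 (jp_a \<alpha> \<beta> 0) (jp_a \<alpha> \<beta>) (jp_b \<alpha> \<beta>) (nat (n + 2))"

definition jp_q :: "real \<Rightarrow> real \<Rightarrow> int \<Rightarrow> int" where
  "jp_q \<alpha> \<beta> n = jp_rec 0 1 (jp_b \<alpha> \<beta> 0) (jp_a \<alpha> \<beta>) (jp_b \<alpha> \<beta>) (nat (n + 2))"

definition jp_Delta :: "real \<Rightarrow> real \<Rightarrow> nat \<Rightarrow> real" where
  "jp_Delta \<alpha> \<beta> n = of_int (jp_p \<alpha> \<beta> (int n)) - \<alpha> * of_int (jp_r \<alpha> \<beta> (int n))"

definition jp_Delta' :: "real \<Rightarrow> real \<Rightarrow> nat \<Rightarrow> real" where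
  "jp_Delta' \<alpha> \<beta> n = of_int (jp_q \<alpha> \<beta> (int n)) - \<beta> * of_int (jp_r \<alpha> \<beta> (int n))"

text \<open>The transformation of the algorithm for \<open>(\<alpha>, \<beta>)\<close>, with its partial quotients, applied to
  another starting pair \<open>(\<alpha>', \<beta>')\<close>.  It is the intended object only while no denominator
  vanishes.\<close>

fun jp_conj :: "real \<Rightarrow> real \<Rightarrow> real \<Rightarrow> real \<Rightarrow> nat \<Rightarrow> real \<times> real" where
  "jp_conj \<alpha> \<beta> \<alpha>' \<beta>' 0 = (\<alpha>', \<beta>')"
| "jp_conj \<alpha> \<beta> \<alpha>' \<beta>' (Suc n) =
     (let (x, y) = jp_conj \<alpha> \<beta> \<alpha>' \<beta>' n in
       ((y - of_int (jp_b \<alpha> \<beta> n)) / (x - of_int (jp_a \<alpha> \<beta> n)),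
        1 / (x - of_int (jp_a \<alpha> \<beta> n))))"

definition alpha_conj :: "real \<Rightarrow> real \<Rightarrow> real \<Rightarrow> real \<Rightarrow> nat \<Rightarrow> real" where
  "alpha_conj \<alpha> \<beta> \<alpha>' \<beta>' n = fst (jp_conj \<alpha> \<beta> \<alpha>' \<beta>' n)"

definition beta_conj :: "real \<Rightarrow> real \<Rightarrow> real \<Rightarrow> real \<Rightarrow> nat \<Rightarrow> real" where
  "beta_conj \<alpha> \<beta> \<alpha>' \<beta>' n = snd (jp_conj \<alpha> \<beta> \<alpha>' \<beta>' n)"

definition Delta_alternate_beyond :: "real \<Rightarrow> real \<Rightarrow> nat \<Rightarrow> bool" where
  "Delta_alternate_beyond \<alpha> \<beta> N \<longleftrightarrow>
     (\<forall>n>N. jp_Delta \<alpha> \<beta> (n - 1) * jp_Delta \<alpha> \<beta> n < 0 \<and>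
             jp_Delta' \<alpha> \<beta> (n - 1) * jp_Delta' \<alpha> \<beta> n < 0)"

end

theory Submission
  imports Defs
begin

text \<open>
  Write \<open>V\<^sub>k = (R\<^sub>k, P\<^sub>k, Q\<^sub>k)\<close> for the integer vectors with entries \<open>r\<^sub>k\<^sub>-\<^sub>2\<close>, \<open>p\<^sub>k\<^sub>-\<^sub>2\<close>, \<open>q\<^sub>k\<^sub>-\<^sub>2\<close>, and let
  \<open>L\<^sub>k(x, y) = det (V\<^sub>k\<^sub>+\<^sub>2, V\<^sub>k\<^sub>+\<^sub>1, (1, x, y)) = C\<^sub>0 + C\<^sub>1 x + C\<^sub>2 y\<close> be the equation, with integer
  coefficients, of the line through two consecutive convergents.

  If \<open>(x\<^sub>n, y\<^sub>n)\<close> arises from a starting point \<open>(x, y)\<close> by running the algorithm with the partial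
  quotients of \<open>(\<alpha>, \<beta>)\<close>, then \<open>y\<^sub>n V\<^sub>n\<^sub>+\<^sub>1 + x\<^sub>n V\<^sub>n + V\<^sub>n\<^sub>-\<^sub>1 = D (1, x, y)\<close>, where \<open>D\<close> is the same
  combination of the first entries.  Since \<open>det (V\<^sub>k\<^sub>+\<^sub>2, V\<^sub>k\<^sub>+\<^sub>1, V\<^sub>k) = -1\<close>, Cramer's rule turns this into
  \<open>D L\<^sub>n\<^sub>-\<^sub>1(x, y) = -1\<close> (\<open>companion_den_line_form\<close>).  The sequence whose limit is wanted is
  \<open>D / R\<^sub>n\<^sub>+\<^sub>1\<close> for the conjugate point, so what has to be shown is that
  \<open>R\<^sub>n\<^sub>+\<^sub>1 \<bar>L\<^sub>n\<^sub>-\<^sub>1(\<alpha>', \<beta>')\<bar>\<close> tends to infinity.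

  Now \<open>L\<^sub>k(\<alpha>', \<beta>') = L\<^sub>k(\<alpha>, \<beta>) + C\<^sub>1 (\<alpha>' - \<alpha>) + C\<^sub>2 (\<beta>' - \<beta>)\<close>.  The first summand is at most
  \<open>1 / R\<^sub>k\<^sub>+\<^sub>2\<close> in absolute value, by the same Cramer identity at the point \<open>(\<alpha>, \<beta>)\<close> itself.
  The coefficients are \<open>C\<^sub>2 = R\<^sub>k\<^sub>+\<^sub>2 \<Delta>\<^sub>k\<^sub>-\<^sub>1 - R\<^sub>k\<^sub>+\<^sub>1 \<Delta>\<^sub>k\<close> and, with the opposite sign, the same expression in
  \<open>\<Delta>'\<close> for \<open>C\<^sub>1\<close>; the alternation of \<open>\<Delta>\<close> and \<open>\<Delta>'\<close> prevents cancellation in both of them, and the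
  sign hypothesis says exactly that \<open>C\<^sub>1 (\<alpha>' - \<alpha>)\<close> and \<open>C\<^sub>2 (\<beta>' - \<beta>)\<close> reinforce each other.
  As \<open>C\<^sub>2\<close> is a nonzero integer, \<open>\<bar>L\<^sub>k(\<alpha>', \<beta>')\<bar> \<ge> \<bar>\<beta>' - \<beta>\<bar> - 1 / R\<^sub>k\<^sub>+\<^sub>2\<close>, and \<open>R\<^sub>k\<close> tends to
  infinity.

  The alternation of \<open>\<Delta>'\<close> comes from that of \<open>\<Delta>\<close>: the quantity
  \<open>L\<^sub>k(\<alpha>, \<beta>) = \<Delta>\<^sub>k \<Delta>'\<^sub>k\<^sub>-\<^sub>1 - \<Delta>'\<^sub>k \<Delta>\<^sub>k\<^sub>-\<^sub>1\<close> is always negative, so \<open>\<Delta>'\<^sub>k / \<Delta>\<^sub>k\<close> is eventually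
  monotone, hence eventually of constant sign (\<open>alternation_transfers\<close>).
\<close>

section \<open>Alternating sequences\<close>

text \<open>The hypothesis on the cross product says that the quotient \<open>e k / d k\<close> decreases as long as
  \<open>d\<close> alternates; a decreasing sequence without zeros changes its sign at most once.\<close>

lemma alternation_transfers:
  fixes d e :: "nat \<Rightarrow> real"
  assumes e: "\<And>k. k \<ge> M \<Longrightarrow> e k \<noteq> 0"
    and alt: "\<And>k. k \<ge> M \<Longrightarrow> d (Suc k) * d k < 0"
    and cross: "\<And>k. k \<ge> M \<Longrightarrow> d (Suc k) * e k - e (Suc k) * d k < 0"
  obtains K where "K \<ge> M" "\<And>k. k \<ge> K \<Longrightarrow> e (Suc k) * e k < 0"
proof -
  define t where "t k = e k / d k" for k
  have d: "d k \<noteq> 0" if "k \<ge> M" for k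
    using alt[OF that] by auto
  have t: "t k \<noteq> 0" if "k \<ge> M" for k
    using e[OF that] d[OF that] by (simp add: t_def)
  have step: "t (Suc k) \<le> t k" if "k \<ge> M" for k
  proof -
    have "t (Suc k) - t k = (e (Suc k) * d k - e k * d (Suc k)) / (d (Suc k) * d k)"
      using d[of k] d[of "Suc k"] that by (simp add: t_def divide_simps)
    also have "\<dots> \<le> 0"
      using alt[OF that] cross[OF that]
      by (intro divide_nonneg_nonpos) (auto simp: algebra_simps)
    finally show ?thesis by simp
  qed
  have mono: "t k \<le> t m" if "k \<ge> m" "m \<ge> M" for k m
    using that by (induction k rule: dec_induct) (auto intro: order_trans[OF step])
  obtain K where K: "K \<ge> M" "\<And>k. k \<ge> K \<Longrightarrow> t (Suc k) * t k > 0"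
  proof (cases "\<exists>m\<ge>M. t m < 0")
    case True
    then obtain m where m: "m \<ge> M" "t m < 0" by blast
    have "t k < 0" if "k \<ge> m" for k
      using mono[OF that m(1)] m(2) by simp
    then show ?thesis
      using m(1) by (intro that[of m]) (auto intro: mult_neg_neg)
  next
    case False
    then have "t k > 0" if "k \<ge> M" for k
      using t[OF that] that by force
    then show ?thesis
      by (intro that[of M]) auto
  qed
  have "e (Suc k) * e k < 0" if "k \<ge> K" for k
  proof -
    have "e (Suc k) * e k = (t (Suc k) * t k) * (d (Suc k) * d k)"
      using d[of k] d[of "Suc k"] that K(1) by (simp add: t_def)
    also have "\<dots> < 0"
      using K that by (intro mult_pos_neg alt) auto
    finally show ?thesis .
  qed
  then show ?thesis using K(1) that by blast
qed

lemma alternating_product_sign: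
  fixes d e :: "nat \<Rightarrow> real"
  assumes "\<And>k. k \<ge> K \<Longrightarrow> d (Suc k) * d k < 0" "\<And>k. k \<ge> K \<Longrightarrow> e (Suc k) * e k < 0"
    and "d K * e K * c < 0" and "k \<ge> K"
  shows "d k * e k * c < 0"
  using assms(4)
proof (induction k rule: dec_induct)
  case base
  show ?case by (rule assms)
next
  case (step k)
  have "0 < (d (Suc k) * d k) * (e (Suc k) * e k)"
    using assms(1)[of k] assms(2)[of k] step by (intro mult_neg_neg) auto
  then have "0 < (d (Suc k) * e (Suc k)) * (d k * e k)"
    by (simp add: mult_ac)
  with step.IH show ?case
    by (smt (verit) mult_less_0_iff zero_less_mult_iff)
qed

section \<open>Convergents and the lines through them\<close>

locale jacobi_perron =
  fixes \<alpha> \<beta> :: real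
  assumes indep: "rat_lin_indep3 1 \<alpha> \<beta>"
begin

abbreviation a where "a \<equiv> jp_a \<alpha> \<beta>"
abbreviation b where "b \<equiv> jp_b \<alpha> \<beta>"

definition R :: "nat \<Rightarrow> int" where "R = jp_rec 0 0 1 a b"
definition P :: "nat \<Rightarrow> int" where "P = jp_rec 1 0 (a 0) a b"
definition Q :: "nat \<Rightarrow> int" where "Q = jp_rec 0 1 (b 0) a b"

definition d :: "nat \<Rightarrow> real" where "d k = P k - \<alpha> * R k"
definition e :: "nat \<Rightarrow> real" where "e k = Q k - \<beta> * R k"

text \<open>The determinant \<open>L\<^sub>k\<close> of the introduction, expanded along its last column \<open>(1, x, y)\<close>.\<close>

definition line_form :: "nat \<Rightarrow> real \<Rightarrow> real \<Rightarrow> real" where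
  "line_form k x y =
     of_int (P (k + 2) * Q (k + 1) - Q (k + 2) * P (k + 1))
     + of_int (Q (k + 2) * R (k + 1) - R (k + 2) * Q (k + 1)) * x
     + of_int (R (k + 2) * P (k + 1) - P (k + 2) * R (k + 1)) * y"

lemma rec_start:
  "R 0 = 0" "R 1 = 0" "R 2 = 1" "P 0 = 1" "P 1 = 0" "P 2 = a 0" "Q 0 = 0" "Q 1 = 1" "Q 2 = b 0"
  by (simp_all add: R_def P_def Q_def numeral_2_eq_2)

lemma rec_step:
  "R (k + 3) = R (k + 2) * b (k + 1) + R (k + 1) * a (k + 1) + R k"
  "P (k + 3) = P (k + 2) * b (k + 1) + P (k + 1) * a (k + 1) + P k"
  "Q (k + 3) = Q (k + 2) * b (k + 1) + Q (k + 1) * a (k + 1) + Q k"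
  by (simp_all add: R_def P_def Q_def numeral_3_eq_3)

text \<open>The recurrence adds multiples of the two later columns to the earliest one, followed by a
  cyclic permutation of the three columns; neither changes the determinant.\<close>

lemma det_convergents:
  "(P (k + 2) * Q (k + 1) - Q (k + 2) * P (k + 1)) * R k
     + (Q (k + 2) * R (k + 1) - R (k + 2) * Q (k + 1)) * P k
     + (R (k + 2) * P (k + 1) - P (k + 2) * R (k + 1)) * Q k = -1"
proof (induction k)
  case 0
  show ?case using rec_start by (simp add: numeral_2_eq_2)
next
  case (Suc k)
  have idx: "Suc k + 2 = k + 3" "Suc k + 1 = k + 2" "Suc k = k + 1" by auto
  show ?case
    unfolding idx(1,2) unfolding idx(3) rec_step using Suc.IH by (simp add: algebra_simps)
qed

text \<open>Passing from the starting point \<open>(\<alpha>, \<beta>)\<close> to \<open>(x, y)\<close> changes the form only through its two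
  leading coefficients, which are expressible by the errors \<open>d\<close> and \<open>e\<close>.\<close>

lemma line_form_shift:
  "line_form k x y = line_form k \<alpha> \<beta>
     - (R (k + 2) * e (k + 1) - R (k + 1) * e (k + 2)) * (x - \<alpha>)
     + (R (k + 2) * d (k + 1) - R (k + 1) * d (k + 2)) * (y - \<beta>)"
  by (simp add: line_form_def d_def e_def algebra_simps)

lemma line_form_self: "line_form k \<alpha> \<beta> = d (k + 2) * e (k + 1) - e (k + 2) * d (k + 1)"
  by (simp add: line_form_def d_def e_def algebra_simps)

section \<open>The algorithm and its companion orbits\<close>

text \<open>The algorithm is its own companion, so each identity for companion orbits also holds for
  the orbit of \<open>(\<alpha>, \<beta>)\<close>.\<close>

lemma jp_eq_jp_conj: "jp \<alpha> \<beta> n = jp_conj \<alpha> \<beta> \<alpha> \<beta> n"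
  by (induction n) (auto simp: frac_def jp_a_def jp_b_def case_prod_beta Let_def)

text \<open>Linear independence passes from each pair of the orbit to the next, because up to the factor
  \<open>frac x\<close> a relation for the new pair is one for the old pair; and independence makes every
  fractional part that the algorithm divides by nonzero.\<close>

lemma jp_indep: "rat_lin_indep3 1 (fst (jp \<alpha> \<beta> n)) (snd (jp \<alpha> \<beta> n))"
  and frac_fst_jp: "frac (fst (jp \<alpha> \<beta> n)) > 0"
proof -
  have pos: "frac x > 0" if "rat_lin_indep3 1 x y" for x y
  proof -
    have "x \<noteq> of_int \<lfloor>x\<rfloor>"
      using that[unfolded rat_lin_indep3_def, rule_format, of "- of_int \<lfloor>x\<rfloor>" 1 0]
      by (auto simp: of_rat_minus)
    then show ?thesis
      by (smt (verit) frac_def frac_ge_0)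
  qed
  show ind: "rat_lin_indep3 1 (fst (jp \<alpha> \<beta> n)) (snd (jp \<alpha> \<beta> n))"
  proof (induction n)
    case 0
    show ?case using indep by simp
  next
    case (Suc n)
    obtain x y where xy: "jp \<alpha> \<beta> n = (x, y)" by force
    have ind: "rat_lin_indep3 1 x y" using Suc.IH xy by simp
    have fx: "frac x > 0" using pos[OF ind] .
    show ?case
      unfolding rat_lin_indep3_def
    proof (intro allI impI)
      fix u v w :: rat
      assume "of_rat u * 1 + of_rat v * fst (jp \<alpha> \<beta> (Suc n))
                + of_rat w * snd (jp \<alpha> \<beta> (Suc n)) = 0"
      then have "(of_rat u * frac x + of_rat v * frac y + of_rat w) / frac x = 0"
        using fx by (simp add: xy add_divide_distrib)
      then have "of_rat u * frac x + of_rat v * frac y + of_rat w = 0"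
        using fx by simp
      then have "of_rat (w - u * of_int \<lfloor>x\<rfloor> - v * of_int \<lfloor>y\<rfloor>) * 1 + of_rat u * x + of_rat v * y = 0"
        by (simp add: frac_def of_rat_diff of_rat_add of_rat_mult algebra_simps)
      then have "w - u * of_int \<lfloor>x\<rfloor> - v * of_int \<lfloor>y\<rfloor> = 0 \<and> u = 0 \<and> v = 0"
        using ind unfolding rat_lin_indep3_def by blast
      then show "u = 0 \<and> v = 0 \<and> w = 0" by auto
    qed
  qed
  show "frac (fst (jp \<alpha> \<beta> n)) > 0" by (rule pos[OF ind])
qed

lemma jp_Suc_bounds: "fst (jp \<alpha> \<beta> (Suc n)) \<ge> 0" "snd (jp \<alpha> \<beta> (Suc n)) \<ge> 1"
  using frac_fst_jp[of n] frac_lt_1[of "fst (jp \<alpha> \<beta> n)"] frac_ge_0[of "snd (jp \<alpha> \<beta> n)"]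
  by (auto simp: case_prod_beta Let_def)

lemma a_nonneg: "a (Suc n) \<ge> 0" and b_pos: "b (Suc n) \<ge> 1"
  using jp_Suc_bounds[of n] by (auto simp: jp_a_def jp_b_def le_floor_iff)

lemma R_bounds: "R k \<ge> 0 \<and> R (k + 1) \<ge> 0 \<and> R (k + 2) \<ge> 1"
proof (induction k)
  case 0
  show ?case using rec_start by (simp add: numeral_2_eq_2)
next
  case (Suc k)
  have "R (k + 2) * 1 \<le> R (k + 2) * b (k + 1)"
    using Suc.IH b_pos[of k] by (intro mult_left_mono) auto
  moreover have "0 \<le> R (k + 1) * a (k + 1)"
    using Suc.IH a_nonneg[of k] by auto
  ultimately have "R (k + 3) \<ge> 1"
    using Suc.IH unfolding rec_step by linarith
  then show ?case using Suc.IH by (simp add: numeral_3_eq_3)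
qed

text \<open>As \<open>b \<ge> 1\<close> and \<open>a \<ge> 0\<close>, the recurrence gives \<open>R (k + 3) \<ge> R (k + 2) + R k\<close>, and \<open>R k \<ge> 1\<close> from
  \<open>k = 2\<close> on.\<close>

lemma R_growth: "R (k + 4) \<ge> int k"
proof (induction k)
  case 0
  show ?case using R_bounds[of 4] by simp
next
  case (Suc k)
  have "R (k + 2 + 3) = R (k + 2 + 2) * b (k + 2 + 1) + R (k + 2 + 1) * a (k + 2 + 1) + R (k + 2)"
    by (rule rec_step)
  moreover have "R (k + 2 + 2) * 1 \<le> R (k + 2 + 2) * b (k + 2 + 1)"
    using R_bounds[of "k + 2"] b_pos[of "k + 2"] by (intro mult_left_mono) auto
  moreover have "0 \<le> R (k + 2 + 1) * a (k + 2 + 1)"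
    using R_bounds[of "k + 2"] a_nonneg[of "k + 2"] by auto
  ultimately have "R (k + 2 + 3) \<ge> R (k + 2 + 2) + 1"
    using R_bounds[of k] by linarith
  moreover have idx: "Suc k + 4 = k + 2 + 3" "k + 4 = k + 2 + 2" by auto
  ultimately show ?case using Suc.IH unfolding idx by linarith
qed

lemma R_at_top: "filterlim (\<lambda>k. real_of_int (R (k + 2))) at_top sequentially"
proof (rule filterlim_at_top_mono)
  show "filterlim (\<lambda>k. - 2 + real k) at_top sequentially"
    by (rule filterlim_tendsto_add_at_top[OF tendsto_const filterlim_real_sequentially])
  show "\<forall>\<^sub>F k in sequentially. - 2 + real k \<le> real_of_int (R (k + 2))"
  proof (rule eventually_sequentiallyI)
    fix k :: nat
    assume "k \<ge> 2"
    then obtain j where j: "k = j + 2" by (metis add.commute le_iff_add)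
    have "real j \<le> real_of_int (R (j + 4))"
      using R_growth[of j] by linarith
    then show "- 2 + real k \<le> real_of_int (R (k + 2))"
      by (simp add: j eval_nat_numeral)
  qed
qed

lemma d_nonzero: "d (k + 2) \<noteq> 0" and e_nonzero: "e (k + 2) \<noteq> 0"
proof -
  have R: "R (k + 2) \<noteq> 0" using R_bounds[of k] by auto
  show "d (k + 2) \<noteq> 0"
    using R indep[unfolded rat_lin_indep3_def, rule_format,
        of "of_int (P (k + 2))" "- of_int (R (k + 2))" 0]
    by (auto simp: d_def of_rat_minus mult.commute)
  show "e (k + 2) \<noteq> 0"
    using R indep[unfolded rat_lin_indep3_def, rule_format,
        of "of_int (Q (k + 2))" 0 "- of_int (R (k + 2))"]
    by (auto simp: e_def of_rat_minus mult.commute)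
qed

text \<open>The factor \<open>D\<close> of the introduction, for the orbit of \<open>(x, y)\<close> at time \<open>k + 1\<close>; divided by
  \<open>R (k + 2)\<close> it is the term of the sequence whose limit is sought.\<close>

definition companion_den :: "real \<Rightarrow> real \<Rightarrow> nat \<Rightarrow> real" where
  "companion_den x y k = R (k + 2) * beta_conj \<alpha> \<beta> x y (k + 1)
     + R (k + 1) * alpha_conj \<alpha> \<beta> x y (k + 1) + R k"

text \<open>One step of the companion orbit inverts one step of the recurrence, up to the factor
  \<open>beta_conj\<close>; this makes \<open>(1, x, y)\<close> proportional to a combination of three consecutive
  convergents.\<close>

lemma companion_combination:
  assumes nz: "\<forall>n. alpha_conj \<alpha> \<beta> x y n - of_int (a n) \<noteq> 0"
  shows "P (k + 2) * beta_conj \<alpha> \<beta> x y (k + 1) + P (k + 1) * alpha_conj \<alpha> \<beta> x y (k + 1) + P k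
           = companion_den x y k * x
       \<and> Q (k + 2) * beta_conj \<alpha> \<beta> x y (k + 1) + Q (k + 1) * alpha_conj \<alpha> \<beta> x y (k + 1) + Q k
           = companion_den x y k * y"
proof -
  define X where "X = alpha_conj \<alpha> \<beta> x y"
  define Y where "Y = beta_conj \<alpha> \<beta> x y"
  have Y: "Y (Suc n) * (X n - of_int (a n)) = 1" for n
    using nz by (simp add: X_def Y_def alpha_conj_def beta_conj_def case_prod_beta Let_def)
  have X: "X (Suc n) = Y (Suc n) * (Y n - of_int (b n))" for n
    by (simp add: X_def Y_def alpha_conj_def beta_conj_def case_prod_beta Let_def)
  have [simp]: "X 0 = x" "Y 0 = y"
    by (simp_all add: X_def Y_def alpha_conj_def beta_conj_def)
  have step: "s3 * Y (Suc n) + s2 * X (Suc n) + s1 = Y (Suc n) * (s2 * Y n + s1 * X n + s0)"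
    if "s3 = s2 * of_int (b n) + s1 * of_int (a n) + s0" for s0 s1 s2 s3 :: real and n
  proof -
    have "Y (Suc n) * (s2 * Y n + s1 * X n + s0) =
        s3 * Y (Suc n) + s2 * (Y (Suc n) * (Y n - of_int (b n)))
          + s1 * (Y (Suc n) * (X n - of_int (a n)))"
      by (simp add: that algebra_simps)
    then show ?thesis using Y[of n] X[of n] by simp
  qed
  have "P (k + 2) * Y (k + 1) + P (k + 1) * X (k + 1) + P k
           = (R (k + 2) * Y (k + 1) + R (k + 1) * X (k + 1) + R k) * x
       \<and> Q (k + 2) * Y (k + 1) + Q (k + 1) * X (k + 1) + Q k
           = (R (k + 2) * Y (k + 1) + R (k + 1) * X (k + 1) + R k) * y"
  proof (induction k)
    case 0
    show ?case
      using X[of 0] Y[of 0] rec_start by (simp add: numeral_2_eq_2 algebra_simps)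
  next
    case (Suc k)
    have idx: "Suc k + 2 = k + 3" "Suc k + 1 = k + 2" "Suc k = k + 1" by auto
    have "S (k + 3) * Y (k + 2) + S (k + 2) * X (k + 2) + S (k + 1)
        = Y (k + 2) * (S (k + 2) * Y (k + 1) + S (k + 1) * X (k + 1) + S k)"
      if "S (k + 3) = S (k + 2) * b (k + 1) + S (k + 1) * a (k + 1) + S k" for S :: "nat \<Rightarrow> int"
      using step[of "S (k + 3)" "S (k + 2)" "k + 1" "S (k + 1)" "S k"] that by simp
    note * = this[of R, OF rec_step(1)] this[of P, OF rec_step(2)] this[of Q, OF rec_step(3)]
    show ?case
      unfolding idx(1,2) unfolding idx(3) * using Suc.IH by (simp add: mult.assoc)
  qed
  then show ?thesis by (simp add: companion_den_def X_def Y_def)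
qed

lemma companion_den_line_form:
  assumes "\<forall>n. alpha_conj \<alpha> \<beta> x y n - of_int (a n) \<noteq> 0"
  shows "companion_den x y k * line_form k x y = -1"
proof -
  define D where "D = companion_den x y k"
  define X where "X = alpha_conj \<alpha> \<beta> x y (k + 1)"
  define Y where "Y = beta_conj \<alpha> \<beta> x y (k + 1)"
  define C0 where "C0 = real_of_int (P (k + 2) * Q (k + 1) - Q (k + 2) * P (k + 1))"
  define C1 where "C1 = real_of_int (Q (k + 2) * R (k + 1) - R (k + 2) * Q (k + 1))"
  define C2 where "C2 = real_of_int (R (k + 2) * P (k + 1) - P (k + 2) * R (k + 1))"
  have "D * line_form k x y = C0 * D + C1 * (D * x) + C2 * (D * y)"
    by (simp add: line_form_def C0_def C1_def C2_def algebra_simps)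
  also have "\<dots> = C0 * (R (k + 2) * Y + R (k + 1) * X + R k)
      + C1 * (P (k + 2) * Y + P (k + 1) * X + P k)
      + C2 * (Q (k + 2) * Y + Q (k + 1) * X + Q k)"
    using companion_combination[OF assms, of k] by (simp add: D_def X_def Y_def companion_den_def)
  also have "\<dots> = C0 * R k + C1 * P k + C2 * Q k"
    by (simp add: C0_def C1_def C2_def algebra_simps)
  also have "\<dots> = -1"
    using arg_cong[OF det_convergents[of k], of real_of_int]
    by (simp add: C0_def C1_def C2_def)
  finally show ?thesis by (simp add: D_def)
qed

text \<open>On the orbit of \<open>(\<alpha>, \<beta>)\<close> itself all terms of the factor \<open>D\<close> are nonnegative and
  \<open>\<beta>\<^sub>k\<^sub>+\<^sub>1 \<ge> 1\<close>, so that \<open>D \<ge> R (k + 2)\<close>; Cramer's rule then gives the sign and the size.\<close>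

lemma line_form_self_bounds: "line_form k \<alpha> \<beta> < 0" "\<bar>line_form k \<alpha> \<beta>\<bar> * R (k + 2) \<le> 1"
proof -
  have "alpha_conj \<alpha> \<beta> \<alpha> \<beta> n - of_int (a n) = frac (fst (jp \<alpha> \<beta> n))" for n
    by (simp add: alpha_conj_def jp_eq_jp_conj jp_a_def frac_def)
  then have "\<forall>n. alpha_conj \<alpha> \<beta> \<alpha> \<beta> n - of_int (a n) \<noteq> 0"
    using frac_fst_jp by (metis less_irrefl)
  from companion_den_line_form[OF this]
  have eq: "companion_den \<alpha> \<beta> k * line_form k \<alpha> \<beta> = -1" .
  have R: "0 \<le> R k" "0 \<le> R (k + 1)" "1 \<le> R (k + 2)"
    using R_bounds[of k] by auto
  have "real_of_int (R (k + 2)) * 1 \<le> R (k + 2) * snd (jp \<alpha> \<beta> (k + 1))"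
    using R jp_Suc_bounds(2)[of k] by (intro mult_left_mono) (simp_all del: jp.simps)
  moreover have "0 \<le> R (k + 1) * fst (jp \<alpha> \<beta> (k + 1))"
    using R jp_Suc_bounds(1)[of k] by (intro mult_nonneg_nonneg) (simp_all del: jp.simps)
  moreover have "0 \<le> real_of_int (R k)" "1 \<le> real_of_int (R (k + 2))"
    using R by auto
  ultimately have D: "R (k + 2) \<le> companion_den \<alpha> \<beta> k" "0 < companion_den \<alpha> \<beta> k"
    unfolding companion_den_def alpha_conj_def beta_conj_def jp_eq_jp_conj by linarith+
  show neg: "line_form k \<alpha> \<beta> < 0"
    using eq D(2) by (smt (verit) mult_nonneg_nonneg)
  have "\<bar>line_form k \<alpha> \<beta>\<bar> * R (k + 2) \<le> \<bar>line_form k \<alpha> \<beta>\<bar> * companion_den \<alpha> \<beta> k"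
    using D(1) by (intro mult_left_mono) auto
  also have "\<dots> = 1"
    using eq neg by (simp add: mult.commute)
  finally show "\<bar>line_form k \<alpha> \<beta>\<bar> * R (k + 2) \<le> 1" .
qed

section \<open>Consequences of alternation\<close>

lemma e_alternates:
  assumes "\<And>k. k \<ge> M \<Longrightarrow> d (k + 3) * d (k + 2) < 0"
  obtains K where "K \<ge> M" "\<And>k. k \<ge> K \<Longrightarrow> e (k + 3) * e (k + 2) < 0"
proof -
  have idx: "Suc k + 2 = k + 3" for k :: nat by simp
  have cross: "d (k + 3) * e (k + 2) - e (k + 3) * d (k + 2) < 0" for k
    using line_form_self_bounds(1)[of "k + 1"] line_form_self[of "k + 1"]
    by (simp add: eval_nat_numeral)
  show ?thesis
    by (rule alternation_transfers[of M "\<lambda>k. e (k + 2)" "\<lambda>k. d (k + 2)"])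
      (use assms e_nonzero cross that in \<open>auto simp only: idx\<close>)
qed

text \<open>The hypotheses describe the signs at a single index.  Both coefficients of the form are then
  sums of terms of one sign, and the two contributions to the change of the form at \<open>(x, y)\<close> add
  up, so that the change is at least the contribution of a nonzero integer coefficient.\<close>

lemma line_form_lower_bound:
  assumes d_alt: "d (k + 3) * d (k + 2) < 0"
    and e_alt: "e (k + 3) * e (k + 2) < 0"
    and sgn: "d (k + 2) * e (k + 2) * ((\<alpha> - x) * (\<beta> - y)) < 0"
  shows "\<bar>line_form (k + 1) x y\<bar> * R (k + 3) \<ge> \<bar>\<beta> - y\<bar> * R (k + 3) - 1"
proof -
  define u where "u = R (k + 3) * e (k + 2) - R (k + 2) * e (k + 3)"
  define v where "v = R (k + 3) * d (k + 2) - R (k + 2) * d (k + 3)"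
  have R: "0 < R (k + 2)" "0 < R (k + 3)"
    using R_bounds[of k] R_bounds[of "k + 1"] by (auto simp: numeral_3_eq_3)
  have shift: "line_form (k + 1) x y = line_form (k + 1) \<alpha> \<beta> + (u * (\<alpha> - x) - v * (\<beta> - y))"
    using line_form_shift[of "k + 1" x y] by (simp add: u_def v_def eval_nat_numeral algebra_simps)
  have no_cancellation: "(R (k + 3) * f - R (k + 2) * g) * f > 0" if "g * f < 0" for f g :: real
  proof -
    have "R (k + 2) * (g * f) < 0"
      using R that by (intro mult_pos_neg[OF _ that]) simp
    moreover have "0 \<le> R (k + 3) * (f * f)"
      using R by simp
    ultimately show ?thesis by (simp add: left_diff_distrib mult.assoc)
  qed
  have u: "u * e (k + 2) > 0" and v: "v * d (k + 2) > 0"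
    unfolding u_def v_def by (rule no_cancellation[OF e_alt], rule no_cancellation[OF d_alt])
  have opposite: "(u * (\<alpha> - x)) * (v * (\<beta> - y)) < 0"
  proof -
    have "0 < (u * e (k + 2)) * (v * d (k + 2))" using u v by simp
    then have "0 < (u * v) * (d (k + 2) * e (k + 2))" by (simp add: mult_ac)
    with sgn have "(u * v) * ((\<alpha> - x) * (\<beta> - y)) < 0"
      by (smt (verit) mult_less_0_iff zero_less_mult_iff)
    then show ?thesis by (simp add: mult_ac)
  qed
  have "v = of_int (R (k + 3) * P (k + 2) - R (k + 2) * P (k + 3))"
    by (simp add: v_def d_def algebra_simps)
  moreover have "v \<noteq> 0" using v by auto
  ultimately have "1 \<le> \<bar>v\<bar>" by (auto simp del: of_int_diff of_int_mult)
  then have "\<bar>\<beta> - y\<bar> \<le> \<bar>v * (\<beta> - y)\<bar>"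
    using mult_right_mono[of 1 "\<bar>v\<bar>" "\<bar>\<beta> - y\<bar>"] by (simp add: abs_mult)
  also have "\<dots> \<le> \<bar>u * (\<alpha> - x) - v * (\<beta> - y)\<bar>"
    using opposite by (smt (verit) mult_less_0_iff)
  also have "\<dots> \<le> \<bar>line_form (k + 1) x y\<bar> + \<bar>line_form (k + 1) \<alpha> \<beta>\<bar>"
    unfolding shift by linarith
  finally have "\<bar>\<beta> - y\<bar> * R (k + 3)
      \<le> (\<bar>line_form (k + 1) x y\<bar> + \<bar>line_form (k + 1) \<alpha> \<beta>\<bar>) * R (k + 3)"
    using R by (intro mult_right_mono) auto
  moreover have "\<bar>line_form (k + 1) \<alpha> \<beta>\<bar> * R (k + 3) \<le> 1"
    using line_form_self_bounds(2)[of "k + 1"] by (simp add: numeral_3_eq_3)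
  ultimately show ?thesis by (simp add: distrib_right)
qed

lemma companion_den_ratio_tendsto_0:
  assumes nz: "\<forall>n. alpha_conj \<alpha> \<beta> x y n - of_int (a n) \<noteq> 0"
    and d_alt: "\<And>k. k \<ge> N \<Longrightarrow> d (k + 3) * d (k + 2) < 0"
    and e_alt: "\<And>k. k \<ge> N \<Longrightarrow> e (k + 3) * e (k + 2) < 0"
    and sgn: "d (N + 2) * e (N + 2) * ((\<alpha> - x) * (\<beta> - y)) < 0"
  shows "(\<lambda>k. companion_den x y k / R (k + 2)) \<longlonglongrightarrow> 0"
proof -
  define B where "B = \<bar>\<beta> - y\<bar>"
  have B: "B > 0" using sgn by (auto simp: B_def)
  have top: "filterlim (\<lambda>k. B * R (k + 2) - 1) at_top sequentially"
    using filterlim_tendsto_add_at_top[OF tendsto_const[of "-1"]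
        filterlim_tendsto_pos_mult_at_top[OF tendsto_const[of B] B R_at_top]]
    by (simp add: add.commute)
  have bound: "B * R (k + 2) - 1 \<le> \<bar>line_form k x y\<bar> * R (k + 2)" if k: "k \<ge> Suc N" for k
  proof -
    obtain j where j: "k = j + 1" "j \<ge> N"
      using k by (cases k) auto
    have "d (j + 2) * e (j + 2) * ((\<alpha> - x) * (\<beta> - y)) < 0"
      using alternating_product_sign[of N "\<lambda>k. d (k + 2)" "\<lambda>k. e (k + 2)" _ j] d_alt e_alt sgn j
      by (simp add: numeral_3_eq_3)
    from line_form_lower_bound[OF d_alt[OF j(2)] e_alt[OF j(2)] this]
    show ?thesis by (simp add: B_def j numeral_3_eq_3)
  qed
  have "filterlim (\<lambda>k. \<bar>line_form k x y\<bar> * R (k + 2)) at_top sequentially"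
    using bound by (intro filterlim_at_top_mono[OF top] eventually_sequentiallyI[of "Suc N"]) auto
  then have "(\<lambda>k. inverse (\<bar>line_form k x y\<bar> * R (k + 2))) \<longlonglongrightarrow> 0"
    by (rule tendsto_inverse_0_at_top)
  moreover have "inverse (\<bar>line_form k x y\<bar> * R (k + 2)) = \<bar>companion_den x y k / R (k + 2)\<bar>" for k
  proof -
    have "\<bar>companion_den x y k\<bar> * \<bar>line_form k x y\<bar> = 1"
      using companion_den_line_form[OF nz, of k] by (simp flip: abs_mult)
    then have "\<bar>companion_den x y k\<bar> = inverse \<bar>line_form k x y\<bar>"
      by (metis inverse_unique mult.commute)
    moreover have "R (k + 2) > 0" using R_bounds[of k] by auto
    ultimately show ?thesis by (simp add: divide_inverse abs_mult)
  qed
  ultimately have "(\<lambda>k. \<bar>companion_den x y k / R (k + 2)\<bar>) \<longlonglongrightarrow> 0" by (simp only:)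
  then show ?thesis by (rule tendsto_rabs_zero_cancel)
qed

section \<open>The limit\<close>

lemma jp_Delta_eq: "jp_Delta \<alpha> \<beta> n = d (n + 2)" "jp_Delta' \<alpha> \<beta> n = e (n + 2)"
  by (simp_all add: jp_Delta_def jp_Delta'_def d_def e_def jp_p_def jp_q_def jp_r_def P_def Q_def
      R_def nat_add_distrib)

lemma Delta_alternate_beyond_iff:
  "Delta_alternate_beyond \<alpha> \<beta> N \<longleftrightarrow>
     (\<forall>k\<ge>N. d (k + 3) * d (k + 2) < 0 \<and> e (k + 3) * e (k + 2) < 0)" (is "_ \<longleftrightarrow> ?rhs")
proof -
  have "(\<forall>n>N. A (n - 1) n) \<longleftrightarrow> (\<forall>k\<ge>N. A k (Suc k))" for A :: "nat \<Rightarrow> nat \<Rightarrow> bool"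
    by (metis Suc_pred' diff_Suc_1 less_Suc_eq_le not_less_zero gr0I)
  then show ?thesis
    by (simp add: Delta_alternate_beyond_def jp_Delta_eq mult.commute numeral_3_eq_3)
qed

lemma companion_ratio_eq:
  "beta_conj \<alpha> \<beta> x y (Suc k)
     + of_int (jp_r \<alpha> \<beta> (int (Suc k) - 2)) / of_int (jp_r \<alpha> \<beta> (int (Suc k) - 1))
         * alpha_conj \<alpha> \<beta> x y (Suc k)
     + of_int (jp_r \<alpha> \<beta> (int (Suc k) - 3)) / of_int (jp_r \<alpha> \<beta> (int (Suc k) - 1))
   = companion_den x y k / R (k + 2)"
proof -
  have r: "jp_r \<alpha> \<beta> (int (Suc k) - 1) = R (k + 2)" "jp_r \<alpha> \<beta> (int (Suc k) - 2) = R (k + 1)"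
    "jp_r \<alpha> \<beta> (int (Suc k) - 3) = R k"
    by (simp_all add: jp_r_def R_def nat_add_distrib)
  have "R (k + 2) > 0" using R_bounds[of k] by auto
  then show ?thesis
    unfolding r by (simp add: companion_den_def field_simps)
qed

end

theorem theorem3p1:
  fixes \<alpha>\<^sub>0 \<beta>\<^sub>0 \<alpha>\<^sub>0' \<beta>\<^sub>0' :: real
  assumes "algebraic \<alpha>\<^sub>0" and "algebraic \<beta>\<^sub>0"
    and "\<alpha>\<^sub>0 \<notin> \<rat>" and "\<beta>\<^sub>0 \<notin> \<rat>"
    and "0 \<le> \<alpha>\<^sub>0" and "\<alpha>\<^sub>0 \<le> \<beta>\<^sub>0" and "1 \<le> \<beta>\<^sub>0"
    and "rat_lin_indep3 1 \<alpha>\<^sub>0 \<beta>\<^sub>0"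
    and "algebraic_conjugates \<alpha>\<^sub>0 \<alpha>\<^sub>0'" and "\<alpha>\<^sub>0' \<noteq> \<alpha>\<^sub>0"
    and "algebraic_conjugates \<beta>\<^sub>0 \<beta>\<^sub>0'" and "\<beta>\<^sub>0' \<noteq> \<beta>\<^sub>0"
    and "\<forall>n. alpha_conj \<alpha>\<^sub>0 \<beta>\<^sub>0 \<alpha>\<^sub>0' \<beta>\<^sub>0' n - of_int (jp_a \<alpha>\<^sub>0 \<beta>\<^sub>0 n) \<noteq> 0"
    and "finite {n. n \<ge> 1 \<and> jp_Delta \<alpha>\<^sub>0 \<beta>\<^sub>0 (n - 1) * jp_Delta \<alpha>\<^sub>0 \<beta>\<^sub>0 n > 0}"
  shows "(\<exists>N. Delta_alternate_beyond \<alpha>\<^sub>0 \<beta>\<^sub>0 N) \<and>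
    (\<forall>N. Delta_alternate_beyond \<alpha>\<^sub>0 \<beta>\<^sub>0 N \<longrightarrow>
       jp_Delta \<alpha>\<^sub>0 \<beta>\<^sub>0 N * jp_Delta' \<alpha>\<^sub>0 \<beta>\<^sub>0 N * (\<alpha>\<^sub>0 - \<alpha>\<^sub>0') * (\<beta>\<^sub>0 - \<beta>\<^sub>0') < 0 \<longrightarrow>
       (\<lambda>n. beta_conj \<alpha>\<^sub>0 \<beta>\<^sub>0 \<alpha>\<^sub>0' \<beta>\<^sub>0' n
            + of_int (jp_r \<alpha>\<^sub>0 \<beta>\<^sub>0 (int n - 2)) / of_int (jp_r \<alpha>\<^sub>0 \<beta>\<^sub>0 (int n - 1))
                * alpha_conj \<alpha>\<^sub>0 \<beta>\<^sub>0 \<alpha>\<^sub>0' \<beta>\<^sub>0' n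
            + of_int (jp_r \<alpha>\<^sub>0 \<beta>\<^sub>0 (int n - 3)) / of_int (jp_r \<alpha>\<^sub>0 \<beta>\<^sub>0 (int n - 1)))
         \<longlonglongrightarrow> 0)"
proof -
  interpret jacobi_perron \<alpha>\<^sub>0 \<beta>\<^sub>0 by unfold_locales fact
  have "\<exists>N. Delta_alternate_beyond \<alpha>\<^sub>0 \<beta>\<^sub>0 N"
  proof -
    obtain M where M: "\<And>n. n \<ge> 1 \<Longrightarrow> jp_Delta \<alpha>\<^sub>0 \<beta>\<^sub>0 (n - 1) * jp_Delta \<alpha>\<^sub>0 \<beta>\<^sub>0 n > 0 \<Longrightarrow> n < M"
      using assms(14) unfolding finite_nat_set_iff_bounded by auto
    have d_alt: "d (k + 3) * d (k + 2) < 0" if "k \<ge> M" for k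
    proof -
      have "\<not> d (k + 2) * d (k + 3) > 0"
        using M[of "k + 1"] that by (auto simp: jp_Delta_eq numeral_3_eq_3)
      moreover have "d (k + 3) * d (k + 2) \<noteq> 0"
        using d_nonzero[of k] d_nonzero[of "k + 1"] by (simp add: numeral_3_eq_3)
      ultimately show ?thesis unfolding mult.commute[of "d (k + 2)"] by linarith
    qed
    obtain K where "K \<ge> M" "\<And>k. k \<ge> K \<Longrightarrow> e (k + 3) * e (k + 2) < 0"
      using e_alternates d_alt by blast
    then have "Delta_alternate_beyond \<alpha>\<^sub>0 \<beta>\<^sub>0 K"
      using d_alt by (simp add: Delta_alternate_beyond_iff)
    then show ?thesis ..
  qed
  moreover have "(\<lambda>n. beta_conj \<alpha>\<^sub>0 \<beta>\<^sub>0 \<alpha>\<^sub>0' \<beta>\<^sub>0' n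
            + of_int (jp_r \<alpha>\<^sub>0 \<beta>\<^sub>0 (int n - 2)) / of_int (jp_r \<alpha>\<^sub>0 \<beta>\<^sub>0 (int n - 1))
                * alpha_conj \<alpha>\<^sub>0 \<beta>\<^sub>0 \<alpha>\<^sub>0' \<beta>\<^sub>0' n
            + of_int (jp_r \<alpha>\<^sub>0 \<beta>\<^sub>0 (int n - 3)) / of_int (jp_r \<alpha>\<^sub>0 \<beta>\<^sub>0 (int n - 1)))
         \<longlonglongrightarrow> 0"
    if alt: "Delta_alternate_beyond \<alpha>\<^sub>0 \<beta>\<^sub>0 N"
      and sgn: "jp_Delta \<alpha>\<^sub>0 \<beta>\<^sub>0 N * jp_Delta' \<alpha>\<^sub>0 \<beta>\<^sub>0 N * (\<alpha>\<^sub>0 - \<alpha>\<^sub>0') * (\<beta>\<^sub>0 - \<beta>\<^sub>0') < 0" for N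
  proof -
    have "(\<lambda>k. companion_den \<alpha>\<^sub>0' \<beta>\<^sub>0' k / R (k + 2)) \<longlonglongrightarrow> 0"
      using companion_den_ratio_tendsto_0[OF assms(13), of N] alt sgn
      by (simp add: Delta_alternate_beyond_iff jp_Delta_eq mult.assoc)
    then show ?thesis
      unfolding companion_ratio_eq[symmetric] by (rule LIMSEQ_imp_Suc)
  qed
  ultimately show ?thesis by blast
qed

end
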